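(* Let $L$ be an MV-algebra and $a\in B(L)$. Then the MV-algebra $L$ is isomorphic to the direct product of the MV-algebras $(Fix_{g_{a^\ast}}(L),\oplus,\circ_2,a^\ast,1)$ and $(Fix_{g_a}(L),\oplus,\circ_1,a,1)$.
   Context: An MV-algebra is an algebra $(L,\oplus,{}^\ast,0)$ of type $(2,1,0)$ such that $(L,\oplus,0)$ is a commutative monoid, $(x^\ast)^\ast=x$, $0^\ast\oplus x=0^\ast$, and $(x^\ast\oplus y)^\ast\oplus y=(y^\ast\oplus x)^\ast\oplus x$ for all $x,y\in L$. Put $1=0^\ast$, $x\rightarrow y=x^\ast\oplus y$. The Boolean center is $B(L)=\{a\in L\mid a\oplus a=a\}$. For $a\in L$ define maps $L\to L$ by $g_a(x)=a\oplus x$ and $g_{a^\ast}(x)=a\rightarrow x=a^\ast\oplus x$. For a map $f:L\to L$, $Fix_f(L)=\{x\in L\mid f(x)=x\}$. For $a\in B(L)$: $(Fix_{g_{a^\ast}}(L),\oplus,\circ_2,a^\ast,1)$ is the MV-algebra with the addition $\oplus$ of $L$, negation $x^{\circ_2}=g_{a^\ast}(x^\ast)$, zero element $a^\ast$ and unit (top) $1$; $(Fix_{g_a}(L),\oplus,\circ_1,a,1)$ is the MV-algebra with the addition $\oplus$ of $L$, negation $x^{\circ_1}=g_a(x^\ast)$, zero element $a$ and unit (top) $1$. *)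

theory Defs
  imports "HOL-Algebra.Group"
begin

record 'a mv = "'a partial_object" +
  mv_add :: "'a \<Rightarrow> 'a \<Rightarrow> 'a" (infixl "\<oplus>\<index>" 65)
  mv_neg :: "'a \<Rightarrow> 'a" ("\<sim>\<index> _" [81] 80)
  mv_zero :: "'a" ("\<zero>\<index>")

locale mv_algebra =
  fixes L :: "('a, 'm) mv_scheme" (structure)
  assumes add_comm_monoid:
      "comm_monoid \<lparr>carrier = carrier L, monoid.mult = mv_add L, one = mv_zero L\<rparr>"
    and neg_closed: "x \<in> carrier L \<Longrightarrow> \<sim> x \<in> carrier L"
    and neg_neg: "x \<in> carrier L \<Longrightarrow> \<sim> (\<sim> x) = x"
    and neg_zero_add: "x \<in> carrier L \<Longrightarrow> \<sim> \<zero> \<oplus> x = \<sim> \<zero>"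
    and lukasiewicz: "x \<in> carrier L \<Longrightarrow> y \<in> carrier L \<Longrightarrow>
      \<sim> (\<sim> x \<oplus> y) \<oplus> y = \<sim> (\<sim> y \<oplus> x) \<oplus> x"

definition mv_one :: "('a, 'm) mv_scheme \<Rightarrow> 'a" where
  "mv_one L = \<sim>\<^bsub>L\<^esub> \<zero>\<^bsub>L\<^esub>"

definition mv_imp :: "('a, 'm) mv_scheme \<Rightarrow> 'a \<Rightarrow> 'a \<Rightarrow> 'a" where
  "mv_imp L x y = \<sim>\<^bsub>L\<^esub> x \<oplus>\<^bsub>L\<^esub> y"

definition boolean_center :: "('a, 'm) mv_scheme \<Rightarrow> 'a set" where
  "boolean_center L = {a \<in> carrier L. a \<oplus>\<^bsub>L\<^esub> a = a}"

definition mv_g :: "('a, 'm) mv_scheme \<Rightarrow> 'a \<Rightarrow> 'a \<Rightarrow> 'a" where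
  "mv_g L a x = a \<oplus>\<^bsub>L\<^esub> x"

definition mv_Fix :: "('a, 'm) mv_scheme \<Rightarrow> ('a \<Rightarrow> 'a) \<Rightarrow> 'a set" where
  "mv_Fix L f = {x \<in> carrier L. f x = x}"

text \<open>The MV-algebra on the fixed points of \<open>mv_g L a\<close>. Its instances at \<open>a\<close> and at
  \<open>\<sim> a\<close> are the two factors of the decomposition; the unit is not a field of the record, but
  is determined as the negation of zero and agrees with that of \<open>L\<close>
  (\<open>mv_one_mv_Fix_algebra\<close> below).\<close>

definition mv_Fix_algebra :: "('a, 'm) mv_scheme \<Rightarrow> 'a \<Rightarrow> 'a mv" where
  "mv_Fix_algebra L a =
    \<lparr>carrier = mv_Fix L (mv_g L a),
     mv_add = mv_add L,
     mv_neg = (\<lambda>x. mv_g L a (\<sim>\<^bsub>L\<^esub> x)),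
     mv_zero = a\<rparr>"

definition mv_DirProd :: "('a, 'm) mv_scheme \<Rightarrow> ('b, 'n) mv_scheme \<Rightarrow> ('a \<times> 'b) mv" where
  "mv_DirProd A B =
    \<lparr>carrier = carrier A \<times> carrier B,
     mv_add = (\<lambda>(x, y) (x', y'). (x \<oplus>\<^bsub>A\<^esub> x', y \<oplus>\<^bsub>B\<^esub> y')),
     mv_neg = (\<lambda>(x, y). (\<sim>\<^bsub>A\<^esub> x, \<sim>\<^bsub>B\<^esub> y)),
     mv_zero = (\<zero>\<^bsub>A\<^esub>, \<zero>\<^bsub>B\<^esub>)\<rparr>"

definition mv_hom :: "('a, 'm) mv_scheme \<Rightarrow> ('b, 'n) mv_scheme \<Rightarrow> ('a \<Rightarrow> 'b) set" where
  "mv_hom A B = {h \<in> carrier A \<rightarrow> carrier B.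
     (\<forall>x\<in>carrier A. \<forall>y\<in>carrier A. h (x \<oplus>\<^bsub>A\<^esub> y) = h x \<oplus>\<^bsub>B\<^esub> h y) \<and>
     (\<forall>x\<in>carrier A. h (\<sim>\<^bsub>A\<^esub> x) = \<sim>\<^bsub>B\<^esub> (h x)) \<and>
     h \<zero>\<^bsub>A\<^esub> = \<zero>\<^bsub>B\<^esub>}"

definition mv_isomorphic :: "('a, 'm) mv_scheme \<Rightarrow> ('b, 'n) mv_scheme \<Rightarrow> bool" where
  "mv_isomorphic A B \<longleftrightarrow> (\<exists>h \<in> mv_hom A B. bij_betw h (carrier A) (carrier B))"

context mv_algebra
begin

lemma add_closed: "x \<in> carrier L \<Longrightarrow> y \<in> carrier L \<Longrightarrow> x \<oplus> y \<in> carrier L"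
  using monoid.m_closed[OF comm_monoid.axioms(1)[OF add_comm_monoid]] by simp

lemma zero_closed: "\<zero> \<in> carrier L"
  using monoid.one_closed[OF comm_monoid.axioms(1)[OF add_comm_monoid]] by simp

lemma add_assoc: "\<lbrakk>x \<in> carrier L; y \<in> carrier L; z \<in> carrier L\<rbrakk> \<Longrightarrow> x \<oplus> y \<oplus> z = x \<oplus> (y \<oplus> z)"
  using monoid.m_assoc[OF comm_monoid.axioms(1)[OF add_comm_monoid]] by simp

lemma add_comm: "\<lbrakk>x \<in> carrier L; y \<in> carrier L\<rbrakk> \<Longrightarrow> x \<oplus> y = y \<oplus> x"
  using comm_monoid.m_comm[OF add_comm_monoid] by simp

lemma zero_add: "x \<in> carrier L \<Longrightarrow> \<zero> \<oplus> x = x"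
  using monoid.l_one[OF comm_monoid.axioms(1)[OF add_comm_monoid]] by simp

lemma neg_add_self:
  assumes x: "x \<in> carrier L"
  shows "\<sim> x \<oplus> x = \<sim> \<zero>"
proof -
  have one: "\<sim> \<zero> \<in> carrier L" and m: "\<sim> (\<sim> x \<oplus> \<sim> \<zero>) \<in> carrier L"
    by (simp_all add: neg_closed zero_closed add_closed x)
  show ?thesis
    using lukasiewicz[OF x one] add_comm[OF m one] neg_zero_add[OF m]
    by (simp add: neg_neg zero_closed zero_add x)
qed

lemma neg_boolean_center:
  assumes a: "a \<in> boolean_center L"
  shows "\<sim> a \<in> boolean_center L"
proof -
  have c: "a \<in> carrier L" and aa: "a \<oplus> a = a"
    using a by (auto simp: boolean_center_def)
  define n where "n = \<sim> a"
  have n: "n \<in> carrier L" and nn: "n \<oplus> n \<in> carrier L" and nnn: "\<sim> (n \<oplus> n) \<in> carrier L"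
    by (simp_all add: n_def c neg_closed add_closed)
  have "\<sim> (\<sim> a \<oplus> n) \<oplus> n = \<sim> (\<sim> n \<oplus> a) \<oplus> a"
    by (rule lukasiewicz[OF c n])
  then have 1: "\<sim> (n \<oplus> n) \<oplus> n = \<sim> \<zero>"
    using neg_add_self[OF c] by (simp add: n_def neg_neg c aa)
  have 2: "\<sim> n \<oplus> (n \<oplus> n) = \<sim> \<zero>"
    using n neg_add_self[OF n] neg_zero_add[OF n] by (simp add: add_assoc[symmetric] neg_closed)
  have "\<sim> (\<sim> (n \<oplus> n) \<oplus> n) \<oplus> n = \<sim> (\<sim> n \<oplus> (n \<oplus> n)) \<oplus> (n \<oplus> n)"
    by (rule lukasiewicz[OF nn n])
  then have "n \<oplus> n = n"
    unfolding 1 2 by (simp add: neg_neg zero_closed zero_add n nn)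
  then show ?thesis
    using n by (simp add: boolean_center_def n_def)
qed

lemma mv_g_neg: "mv_g L (\<sim> a) = mv_imp L a"
  by (simp add: mv_g_def mv_imp_def fun_eq_iff)

lemma mv_one_mv_Fix_algebra:
  assumes "a \<in> boolean_center L"
  shows "mv_one (mv_Fix_algebra L a) = mv_one L"
  using assms neg_add_self
  by (simp add: mv_one_def mv_Fix_algebra_def mv_g_def boolean_center_def add_comm neg_closed)

lemma mv_algebra_mv_Fix_algebra:
  assumes a: "a \<in> boolean_center L"
  shows "mv_algebra (mv_Fix_algebra L a)"
proof -
  have c: "a \<in> carrier L" and aa: "a \<oplus> a = a"
    using a by (auto simp: boolean_center_def)
  have fix_assoc: "a \<oplus> (x \<oplus> y) = x \<oplus> y"
    if "x \<in> carrier L" "y \<in> carrier L" "a \<oplus> x = x" for x y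
    using that c add_assoc[of a x y] by simp
  have aax: "a \<oplus> (a \<oplus> x) = a \<oplus> x" if "x \<in> carrier L" for x
    using that c aa add_assoc[of a a x] by simp
  have join: "a \<oplus> \<sim> (a \<oplus> \<sim> x \<oplus> y) \<oplus> y = \<sim> (\<sim> x \<oplus> y) \<oplus> y"
    if x: "x \<in> carrier L" and y: "y \<in> carrier L" and fy: "a \<oplus> y = y" for x y
  proof -
    have "a \<oplus> z \<oplus> y = z \<oplus> y" if "z \<in> carrier L" for z
      using that y fy c add_assoc[of z a y] add_comm[of a z] by simp
    then show ?thesis
      using x y by (simp add: neg_closed add_closed)
  qed
  have dneg: "a \<oplus> \<sim> (a \<oplus> \<sim> x) = x" if x: "x \<in> carrier L" and fx: "a \<oplus> x = x" for x
  proof -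
    have 1: "\<sim> a \<oplus> x = \<sim> \<zero>"
      using add_assoc[OF neg_closed[OF c] c x] neg_add_self[OF c] neg_zero_add[OF x] fx by simp
    have "\<sim> (\<sim> x \<oplus> a) \<oplus> a = \<sim> (\<sim> a \<oplus> x) \<oplus> x"
      by (rule lukasiewicz[OF x c])
    also have "\<dots> = x"
      unfolding 1 by (simp add: neg_neg zero_closed zero_add x)
    finally show ?thesis
      using x c add_comm[of a "\<sim> x"] add_comm[of a "\<sim> (\<sim> x \<oplus> a)"]
      by (simp add: neg_closed add_closed)
  qed
  show ?thesis
  proof (intro mv_algebra.intro)
    show "comm_monoid \<lparr>carrier = carrier (mv_Fix_algebra L a),
        monoid.mult = mv_add (mv_Fix_algebra L a), one = mv_zero (mv_Fix_algebra L a)\<rparr>"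
      by (rule comm_monoidI)
        (auto simp: mv_Fix_algebra_def mv_Fix_def mv_g_def add_closed add_assoc c aa fix_assoc
          intro: add_comm)
  next
    fix x y
    assume "x \<in> carrier (mv_Fix_algebra L a)"
    then have x: "x \<in> carrier L" and fx: "a \<oplus> x = x"
      by (auto simp: mv_Fix_algebra_def mv_Fix_def mv_g_def)
    show "\<sim>\<^bsub>mv_Fix_algebra L a\<^esub> x \<in> carrier (mv_Fix_algebra L a)"
      using x c by (simp add: mv_Fix_algebra_def mv_Fix_def mv_g_def add_closed neg_closed aax)
    show "\<sim>\<^bsub>mv_Fix_algebra L a\<^esub> (\<sim>\<^bsub>mv_Fix_algebra L a\<^esub> x) = x"
      using dneg[OF x fx] by (simp add: mv_Fix_algebra_def mv_g_def)
    show "\<sim>\<^bsub>mv_Fix_algebra L a\<^esub> \<zero>\<^bsub>mv_Fix_algebra L a\<^esub> \<oplus>\<^bsub>mv_Fix_algebra L a\<^esub> x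
        = \<sim>\<^bsub>mv_Fix_algebra L a\<^esub> \<zero>\<^bsub>mv_Fix_algebra L a\<^esub>"
      using neg_add_self[OF c] neg_zero_add[OF x] add_comm[OF c neg_closed[OF c]]
      by (simp add: mv_Fix_algebra_def mv_g_def)
    assume "y \<in> carrier (mv_Fix_algebra L a)"
    then have y: "y \<in> carrier L" and fy: "a \<oplus> y = y"
      by (auto simp: mv_Fix_algebra_def mv_Fix_def mv_g_def)
    show "\<sim>\<^bsub>mv_Fix_algebra L a\<^esub> (\<sim>\<^bsub>mv_Fix_algebra L a\<^esub> x \<oplus>\<^bsub>mv_Fix_algebra L a\<^esub> y)
          \<oplus>\<^bsub>mv_Fix_algebra L a\<^esub> y
        = \<sim>\<^bsub>mv_Fix_algebra L a\<^esub> (\<sim>\<^bsub>mv_Fix_algebra L a\<^esub> y \<oplus>\<^bsub>mv_Fix_algebra L a\<^esub> x)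
          \<oplus>\<^bsub>mv_Fix_algebra L a\<^esub> x"
      using join[OF x y fy] join[OF y x fx] lukasiewicz[OF x y]
      by (simp add: mv_Fix_algebra_def mv_g_def)
  qed
qed

end

end

(* The isomorphism is x \<mapsto> (\<sim> a \<oplus> x, a \<oplus> x), with inverse (q, p) \<mapsto> \<sim> (\<sim> p \<oplus> \<sim> q), the
   Lukasiewicz product of q and p. Everything rests on the identity a \<oplus> \<sim> (a \<oplus> x) = a \<oplus> \<sim> x for
   Boolean a, which says that adding a Boolean element is the same as joining with it. *)
theory Submission
  imports Defs
begin

context mv_algebra
begin

lemma add_left_comm:
  "\<lbrakk>x \<in> carrier L; y \<in> carrier L; z \<in> carrier L\<rbrakk> \<Longrightarrow> x \<oplus> (y \<oplus> z) = y \<oplus> (x \<oplus> z)"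
  by (metis add_assoc add_comm)

lemma add_neg_self: "x \<in> carrier L \<Longrightarrow> x \<oplus> \<sim> x = \<sim> \<zero>"
  by (metis add_comm neg_add_self neg_closed)

lemma add_one: "x \<in> carrier L \<Longrightarrow> x \<oplus> \<sim> \<zero> = \<sim> \<zero>"
  by (metis add_comm neg_zero_add neg_closed zero_closed)

lemma neg_one_add: "x \<in> carrier L \<Longrightarrow> \<sim> (\<sim> \<zero>) \<oplus> x = x"
  by (simp add: neg_neg zero_add zero_closed)

text \<open>In the natural order, \<open>x\<close> lies below \<open>y\<close> exactly when
  \<open>\<sim> x \<oplus> y\<close> is the unit. Both sides of the Lukasiewicz identity are the
  join of \<open>x\<close> and \<open>y\<close>; the two hypotheses collapse one side to
  \<open>y\<close> and the other to \<open>x\<close>.\<close>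

lemma le_antisym:
  assumes "x \<in> carrier L" "y \<in> carrier L" "\<sim> x \<oplus> y = \<sim> \<zero>" "\<sim> y \<oplus> x = \<sim> \<zero>"
  shows "x = y"
  using lukasiewicz[of x y] assms by (simp add: neg_one_add)

context
  fixes a
  assumes a: "a \<in> boolean_center L"
begin

lemma boolean_closed: "a \<in> carrier L"
  using a by (simp add: boolean_center_def)

lemma boolean_add_add: "x \<in> carrier L \<Longrightarrow> a \<oplus> (a \<oplus> x) = a \<oplus> x"
  using a by (simp add: boolean_center_def flip: add_assoc)

lemma boolean_add_neg_add:
  assumes x: "x \<in> carrier L"
  shows "a \<oplus> \<sim> (a \<oplus> x) = a \<oplus> \<sim> x"
proof -
  note c = boolean_closed
  define p where "p = a \<oplus> x"
  have p: "p \<in> carrier L" and ap: "a \<oplus> p = p"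
    using x c by (simp_all add: p_def add_closed boolean_add_add)
  define w where "w = a \<oplus> \<sim> p"
  have w: "w \<in> carrier L"
    by (simp add: w_def add_closed c neg_closed p)
  have "\<sim> a \<oplus> p = \<sim> \<zero>"
    using c x by (simp add: p_def neg_add_self neg_closed neg_zero_add flip: add_assoc)
  \<comment> \<open>The left side is the join of \<open>p\<close> and \<open>a\<close>, and
    \<open>a\<close> lies below \<open>p\<close>. Since \<open>\<sim> p \<oplus> a\<close> is
    \<open>w\<close>, this recovers \<open>p\<close> from \<open>w\<close>.\<close>
  then have "\<sim> (\<sim> p \<oplus> a) \<oplus> a = p"
    using lukasiewicz[OF p c] p by (simp add: neg_one_add)
  then have wa: "a \<oplus> \<sim> w = p"
    by (metis w_def add_comm c p w neg_closed)
  \<comment> \<open>Thus \<open>w\<close> is the join of \<open>a\<close> and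
    \<open>\<sim> x\<close>, to be compared with their sum.\<close>
  have join: "w = \<sim> (\<sim> a \<oplus> \<sim> x) \<oplus> \<sim> x"
    using lukasiewicz[of a "\<sim> x"] x c
    by (simp add: w_def p_def neg_neg neg_closed add_closed add_comm)
  have aw: "a \<oplus> w = w"
    by (simp add: w_def boolean_add_add neg_closed p)
  have "w = a \<oplus> \<sim> x"
  proof (rule le_antisym)
    have "\<sim> w \<oplus> (a \<oplus> \<sim> x) = p \<oplus> \<sim> x"
      using wa c w x by (simp add: add_comm neg_closed flip: add_assoc)
    also have "\<dots> = \<sim> \<zero>"
      using x c by (simp add: p_def add_assoc neg_closed add_neg_self add_one)
    finally show "\<sim> w \<oplus> (a \<oplus> \<sim> x) = \<sim> \<zero>" .
    define u where "u = \<sim> (\<sim> a \<oplus> \<sim> x)"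
    have u: "u \<in> carrier L"
      using x c by (simp add: u_def add_closed neg_closed)
    have ax: "a \<oplus> \<sim> x \<in> carrier L"
      using x c by (simp add: add_closed neg_closed)
    \<comment> \<open>Idempotence of \<open>a\<close> enters here: as \<open>w\<close> absorbs
      \<open>a\<close>, an extra summand \<open>a\<close> may be put into
      \<open>u \<oplus> \<sim> x\<close>. This exhibits \<open>w\<close> as a sum containing
      \<open>a \<oplus> \<sim> x\<close>, hence above it.\<close>
    have "w = u \<oplus> (a \<oplus> \<sim> x)"
      using aw join u x c by (metis u_def add_left_comm neg_closed)
    then show "\<sim> (a \<oplus> \<sim> x) \<oplus> w = \<sim> \<zero>"
      using u ax by (metis add_left_comm add_one neg_add_self neg_closed)
  qed (use w x c in \<open>simp_all add: add_closed neg_closed\<close>)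
  then show ?thesis
    by (simp add: w_def p_def)
qed

lemma boolean_add_distrib:
  assumes "x \<in> carrier L" "y \<in> carrier L"
  shows "a \<oplus> (x \<oplus> y) = (a \<oplus> x) \<oplus> (a \<oplus> y)"
  using assms boolean_closed
  by (simp add: add_assoc add_closed add_left_comm[of x a y] boolean_add_add)

text \<open>Recovers a component from the product used as inverse. Since \<open>q\<close> lies above
  \<open>\<sim> a\<close>, its negation lies below \<open>a\<close> and is absorbed by it, so under
  \<open>a \<oplus> _\<close> only the factor \<open>p\<close> survives.\<close>

lemma boolean_add_mult:
  assumes "p \<in> carrier L" "q \<in> carrier L" "a \<oplus> p = p" "\<sim> a \<oplus> q = q"
  shows "a \<oplus> \<sim> (\<sim> p \<oplus> \<sim> q) = p"
proof -
  note c = boolean_closed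
  have aq: "a \<oplus> q = \<sim> \<zero>"
    using assms c by (metis add_assoc add_neg_self neg_closed neg_zero_add)
  have "a \<oplus> \<sim> q = a \<oplus> \<sim> (a \<oplus> q)"
    by (simp add: assms boolean_add_neg_add)
  also have "\<dots> = a"
    using c by (metis aq add_comm neg_neg zero_add zero_closed)
  finally have anq: "a \<oplus> \<sim> q = a" .
  have "a \<oplus> \<sim> (\<sim> p \<oplus> \<sim> q) = a \<oplus> \<sim> (a \<oplus> (\<sim> p \<oplus> \<sim> q))"
    by (simp add: assms add_closed neg_closed boolean_add_neg_add)
  also have "a \<oplus> (\<sim> p \<oplus> \<sim> q) = a \<oplus> \<sim> p"
    using assms c anq by (simp add: add_left_comm[of a] add_comm neg_closed)
  also have "a \<oplus> \<sim> (a \<oplus> \<sim> p) = p"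
    using assms by (simp add: boolean_add_neg_add neg_closed neg_neg)
  finally show ?thesis .
qed

text \<open>The hypothesis on \<open>\<sim> a\<close> puts \<open>a\<close> below \<open>z\<close>,
  so \<open>z\<close> is its own join with \<open>a\<close>. For Boolean \<open>a\<close> this join
  is \<open>a \<oplus> z\<close>, which the other hypothesis makes the unit.\<close>

lemma boolean_add_eq_one:
  assumes z: "z \<in> carrier L" and "a \<oplus> z = \<sim> \<zero>" "\<sim> a \<oplus> z = \<sim> \<zero>"
  shows "z = \<sim> \<zero>"
proof -
  note c = boolean_closed
  have "z = \<sim> (\<sim> a \<oplus> z) \<oplus> z"
    using assms by (simp add: neg_one_add)
  also have "\<dots> = \<sim> (\<sim> z \<oplus> a) \<oplus> a"
    by (rule lukasiewicz[OF c z])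
  also have "\<dots> = a \<oplus> \<sim> (a \<oplus> \<sim> z)"
    using z c by (simp add: add_comm add_closed neg_closed)
  also have "\<dots> = a \<oplus> z"
    using z by (simp add: boolean_add_neg_add neg_closed neg_neg)
  finally show ?thesis
    using assms by simp
qed

text \<open>By \<open>boolean_add_neg_add\<close>, \<open>a \<oplus> \<sim> x\<close> depends on
  \<open>x\<close> only through \<open>a \<oplus> x\<close>, so \<open>y\<close> may replace
  \<open>x\<close> there; what results contains \<open>a \<oplus> y\<close> together with its
  negation.\<close>

lemma boolean_add_imp_eq_one:
  assumes x: "x \<in> carrier L" and y: "y \<in> carrier L" and eq: "a \<oplus> x = a \<oplus> y"
  shows "a \<oplus> (\<sim> x \<oplus> y) = \<sim> \<zero>"
proof -
  note c = boolean_closed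
  have "a \<oplus> (\<sim> x \<oplus> y) = (a \<oplus> \<sim> x) \<oplus> y"
    using x y c by (simp add: add_assoc neg_closed)
  also have "\<dots> = (a \<oplus> \<sim> (a \<oplus> y)) \<oplus> y"
    using x eq by (simp add: boolean_add_neg_add flip: eq)
  also have "\<dots> = \<sim> (a \<oplus> y) \<oplus> (a \<oplus> y)"
    using y c by (simp add: add_assoc add_closed neg_closed add_left_comm[of a])
  finally show ?thesis
    using y c by (simp add: neg_add_self add_closed)
qed

end

text \<open>Each of \<open>\<sim> x \<oplus> y\<close> and \<open>\<sim> y \<oplus> x\<close>
  becomes the unit after adding \<open>a\<close> and after adding \<open>\<sim> a\<close>, so it is
  already the unit; antisymmetry concludes.\<close>

lemma boolean_add_inject:
  assumes a: "a \<in> boolean_center L" and x: "x \<in> carrier L" and y: "y \<in> carrier L"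
    and eq: "a \<oplus> x = a \<oplus> y" "\<sim> a \<oplus> x = \<sim> a \<oplus> y"
  shows "x = y"
proof -
  note b = neg_boolean_center[OF a]
  have "\<sim> x \<oplus> y = \<sim> \<zero>"
    using boolean_add_eq_one[OF a] boolean_add_imp_eq_one[OF a x y]
      boolean_add_imp_eq_one[OF b x y] eq x y by (simp add: add_closed neg_closed)
  moreover have "\<sim> y \<oplus> x = \<sim> \<zero>"
    using boolean_add_eq_one[OF a] boolean_add_imp_eq_one[OF a y x]
      boolean_add_imp_eq_one[OF b y x] eq x y by (simp add: add_closed neg_closed)
  ultimately show ?thesis
    by (rule le_antisym[OF x y])
qed

text \<open>Idempotence of \<open>a\<close> makes the map additive. Negation in the target is \<sim>
  followed by adding \<open>a\<close>, so its preservation is exactly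
  \<open>boolean_add_neg_add\<close>.\<close>

lemma mv_g_hom:
  assumes a: "a \<in> boolean_center L"
  shows "mv_g L a \<in> mv_hom L (mv_Fix_algebra L a)"
proof -
  have "a \<oplus> \<zero> = a"
    using boolean_closed[OF a] by (metis add_comm zero_add zero_closed)
  then show ?thesis
    using boolean_closed[OF a]
    by (auto simp: mv_hom_def mv_Fix_algebra_def mv_Fix_def mv_g_def add_closed
        boolean_add_add[OF a] boolean_add_neg_add[OF a] simp flip: boolean_add_distrib[OF a])
qed

lemma mv_hom_DirProd:
  assumes "f \<in> mv_hom L A" "g \<in> mv_hom L B"
  shows "(\<lambda>x. (f x, g x)) \<in> mv_hom L (mv_DirProd A B)"
  using assms by (auto simp: mv_hom_def mv_DirProd_def)

lemma bij_betw_mv_Fix_DirProd: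
  assumes a: "a \<in> boolean_center L"
  shows "bij_betw (\<lambda>x. (mv_g L (\<sim> a) x, mv_g L a x)) (carrier L)
    (mv_Fix L (mv_g L (\<sim> a)) \<times> mv_Fix L (mv_g L a))"
proof (rule bij_betw_imageI)
  note c = boolean_closed[OF a] and b = neg_boolean_center[OF a]
  show "inj_on (\<lambda>x. (mv_g L (\<sim> a) x, mv_g L a x)) (carrier L)"
    by (auto simp: inj_on_def mv_g_def intro: boolean_add_inject[OF a])
  show "(\<lambda>x. (mv_g L (\<sim> a) x, mv_g L a x)) ` carrier L =
    mv_Fix L (mv_g L (\<sim> a)) \<times> mv_Fix L (mv_g L a)" (is "?h ` _ = ?R")
  proof
    show "?h ` carrier L \<subseteq> ?R"
      using c by (auto simp: mv_Fix_def mv_g_def add_closed neg_closed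
          boolean_add_add[OF a] boolean_add_add[OF b])
    show "?R \<subseteq> ?h ` carrier L"
    proof clarify
      fix q p assume "q \<in> mv_Fix L (mv_g L (\<sim> a))" "p \<in> mv_Fix L (mv_g L a)"
      then have q: "q \<in> carrier L" "\<sim> a \<oplus> q = q" and p: "p \<in> carrier L" "a \<oplus> p = p"
        by (auto simp: mv_Fix_def mv_g_def)
      define x where "x = \<sim> (\<sim> p \<oplus> \<sim> q)"
      have "a \<oplus> x = p"
        unfolding x_def using p q by (intro boolean_add_mult[OF a])
      \<comment> \<open>The same lemma for the Boolean element \<open>\<sim> a\<close>, with
        \<open>p\<close> and \<open>q\<close> exchanged; \<open>neg_neg\<close> turns its condition
        on \<open>p\<close> back into one about \<open>a\<close>.\<close>
      moreover have "\<sim> a \<oplus> \<sim> (\<sim> q \<oplus> \<sim> p) = q"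
        using p q c by (intro boolean_add_mult[OF b]) (simp_all add: neg_neg)
      then have "\<sim> a \<oplus> x = q"
        using p q by (simp add: x_def add_comm neg_closed)
      moreover have "x \<in> carrier L"
        using p q by (simp add: x_def add_closed neg_closed)
      ultimately show "(q, p) \<in> ?h ` carrier L"
        by (auto simp: mv_g_def intro!: image_eqI[of _ _ x])
    qed
  qed
qed

end

theorem theorem4p17:
  fixes L :: "('a, 'm) mv_scheme" and a :: 'a
  assumes "mv_algebra L"
    and "a \<in> boolean_center L"
  shows "mv_isomorphic L
    (mv_DirProd (mv_Fix_algebra L (\<sim>\<^bsub>L\<^esub> a)) (mv_Fix_algebra L a))"
proof -
  interpret mv_algebra L by fact
  have "carrier (mv_DirProd (mv_Fix_algebra L (\<sim>\<^bsub>L\<^esub> a)) (mv_Fix_algebra L a))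
      = mv_Fix L (mv_g L (\<sim>\<^bsub>L\<^esub> a)) \<times> mv_Fix L (mv_g L a)"
    by (simp add: mv_DirProd_def mv_Fix_algebra_def)
  then show ?thesis
    unfolding mv_isomorphic_def
    by (intro bexI[where x = "\<lambda>x. (mv_g L (\<sim>\<^bsub>L\<^esub> a) x, mv_g L a x)"] mv_hom_DirProd mv_g_hom
        neg_boolean_center assms)
      (simp add: bij_betw_mv_Fix_DirProd assms)
qed

end
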